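(* Let $A$ be an asymmetric fuzzy number such that $[A]_1=\{a_m\}$, let $a<b$ be real numbers, and let $l\geq 0$ be an integer. (i) If $f:[a,b]\to\mathbb{R}_{\mathcal{F}(A)}$ is an integrable function such that $$\int_a^b f(t)\odot\eta(t)\,dt\in\mathbb{R}_{\mathcal{F}(A)}^0$$ for every $\eta\in C^l([a,b],\mathbb{R}_{\mathcal{F}(A)})$ with $\eta^{(j)}(a)=\eta^{(j)}(b)=0$, $j=0,1,\dots,l$, then $f(t)\in\mathbb{R}_{\mathcal{F}(A)}^0$ for almost every $t\in[a,b]$. (ii) If $f:[a,b]\to\mathbb{R}_{\mathcal{F}(A)}$ is an integrable function such that $$\int_a^b f(t)\odot\eta(t)\,dt=0$$ for every $\eta\in C^l([a,b],\mathbb{R}_{\mathcal{F}(A)})$ with $\eta^{(j)}(a)=\eta^{(j)}(b)=0$, $j=0,1,\dots,l$, then $f(t)=0$ for almost every $t\in[a,b]$.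
   Context: A fuzzy subset of $\mathbb{R}$ is a function $A:\mathbb{R}\to[0,1]$; its $\alpha$-levels are $[A]_\alpha=\{x: A(x)\geq\alpha\}$ for $0<\alpha\leq1$ and $[A]_0=\overline{\{x:A(x)>0\}}$. $A$ is a fuzzy number if all its $\alpha$-levels are nonempty closed intervals and $\{x:A(x)>0\}$ is bounded. For $r,q\in\mathbb{R}$, $r+qA$ is the fuzzy number with $[r+qA]_\alpha=\{r+qx: x\in[A]_\alpha\}$ for every $\alpha\in[0,1]$; $r+0A$ is identified with the real number $r$. $A$ is asymmetric if for every $x\in\mathbb{R}$ there exists $y\in\mathbb{R}$ with $A(x-y)\neq A(x+y)$. Put $\mathbb{R}_{\mathcal{F}(A)}=\{r+qA: r,q\in\mathbb{R}\}$. When $A$ is asymmetric, $(r,q)\mapsto r+qA$ is a bijection from $\mathbb{R}^2$ onto $\mathbb{R}_{\mathcal{F}(A)}$, and $\mathbb{R}_{\mathcal{F}(A)}$ is a 2-dimensional real vector space with $(r_B+q_BA)\oplus(r_C+q_CA)=(r_B+r_C)+(q_B+q_C)A$ and $\lambda(r+qA)=\lambda r+(\lambda q)A$, normed by $\|r+qA\|=|q|+|r+qa_m|$. $\Psi$-cross product (for $[A]_1=\{a_m\}$): for $B=r_B+q_BA$, $C=r_C+q_CA$ with $[B]_1=\{b\}$, $[C]_1=\{c\}$, $B\odot C=cB+bC-bc$ (sum in the vector space $\mathbb{R}_{\mathcal{F}(A)}$ with addition $\oplus$, i.e. $B\odot C=cB\oplus bC\oplus(-bc)$), equivalently $B\odot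 C=(r_Br_C-a_m^2q_Bq_C)+(r_Bq_C+r_Cq_B+2a_mq_Bq_C)A$. Also $B^2=B\odot B$ and $\mathbb{R}_{\mathcal{F}(A)}^0=\{B: B^2=0\}=\{r+qA: r+qa_m=0\}$. Integrability is Riemann integrability in the Banach space $\mathbb{R}_{\mathcal{F}(A)}$; $f=r(\cdot)+q(\cdot)A$ is integrable iff $r,q$ are Riemann integrable, and then $\int_a^b f=\int_a^b r+\left(\int_a^b q\right)A$. Derivatives are taken in the normed space, and equal the componentwise derivatives: $\eta'=r_\eta'+q_\eta'A$ for $\eta=r_\eta+q_\eta A$. $C^l([a,b],\mathbb{R}_{\mathcal{F}(A)})$ is the set of $l$ times continuously differentiable functions on $[a,b]$ (one-sided derivatives at endpoints; $C^0$ = continuous). "Almost every" refers to Lebesgue measure. *)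

theory Defs
  imports "HOL-Analysis.Analysis"
begin

definition fuzzy_level :: "(real \<Rightarrow> real) \<Rightarrow> real \<Rightarrow> real set" where
  "fuzzy_level A \<alpha> = (if \<alpha> = 0 then closure {x. A x > 0} else {x. A x \<ge> \<alpha>})"

definition fuzzy_number :: "(real \<Rightarrow> real) \<Rightarrow> bool" where
  "fuzzy_number A \<longleftrightarrow>
     (\<forall>x. A x \<in> {0..1}) \<and>
     (\<forall>\<alpha>\<in>{0..1}. \<exists>c d. c \<le> d \<and> fuzzy_level A \<alpha> = {c..d}) \<and>
     bounded {x. A x > 0}"

definition asymmetric_fuzzy :: "(real \<Rightarrow> real) \<Rightarrow> bool" where
  "asymmetric_fuzzy A \<longleftrightarrow> (\<forall>x. \<exists>y. A (x - y) \<noteq> A (x + y))"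

text \<open>The fuzzy number r + q A, determined by its levels. The explicit form, and thereby
  existence and uniqueness, is lemma \<open>fuzzy_affine_eq\<close> below; in particular r + 0 A is the
  indicator function of {r}, i.e. the real number r.\<close>

definition fuzzy_affine :: "(real \<Rightarrow> real) \<Rightarrow> real \<Rightarrow> real \<Rightarrow> (real \<Rightarrow> real)" where
  "fuzzy_affine A r q = (THE B. fuzzy_number B \<and>
     (\<forall>\<alpha>\<in>{0..1}. fuzzy_level B \<alpha> = (\<lambda>x. r + q * x) ` fuzzy_level A \<alpha>))"

lemma fuzzy_number_eqI:
  assumes "fuzzy_number B" "fuzzy_number C"
    and eq: "\<And>\<alpha>. \<alpha> \<in> {0..1} \<Longrightarrow> fuzzy_level B \<alpha> = fuzzy_level C \<alpha>"
  shows "B = C"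
proof
  fix x
  have *: "F x \<le> G x"
    if "fuzzy_number F" "fuzzy_number G"
      "\<And>\<alpha>. \<alpha> \<in> {0..1} \<Longrightarrow> fuzzy_level F \<alpha> = fuzzy_level G \<alpha>" for F G
  proof (cases "F x = 0")
    case True
    then show ?thesis using that(2) by (simp add: fuzzy_number_def)
  next
    case False
    have "F x \<in> {0..1}" using that(1) by (simp add: fuzzy_number_def)
    then have "fuzzy_level F (F x) = fuzzy_level G (F x)" by (rule that(3))
    then show ?thesis using False by (auto simp: fuzzy_level_def)
  qed
  show "B x = C x" using *[of B C] *[of C B] assms by force
qed

lemma fuzzy_level_affine:
  assumes "q \<noteq> 0"
  shows "fuzzy_level (\<lambda>x. A ((x - r) / q)) \<alpha> = (\<lambda>x. r + q * x) ` fuzzy_level A \<alpha>"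
proof -
  have pre: "{x. P (A ((x - r) / q))} = (\<lambda>x. r + q * x) ` {x. P (A x)}" for P
  proof (intro set_eqI iffI)
    fix x assume "x \<in> {x. P (A ((x - r) / q))}"
    then show "x \<in> (\<lambda>x. r + q * x) ` {x. P (A x)}"
      using assms by (intro image_eqI[where x = "(x - r) / q"]) auto
  qed (use assms in auto)
  have "closure ((\<lambda>x. r + q * x) ` S) = (\<lambda>x. r + q * x) ` closure S" for S
  proof -
    have "(\<lambda>x. r + q * x) ` closure S = (+) r ` ((*) q ` closure S)"
      by (simp add: image_image)
    also have "\<dots> = (+) r ` closure ((*) q ` S)"
      using closure_scaleR[of q S] by simp
    also have "\<dots> = closure ((+) r ` (*) q ` S)"
      by (rule closure_translation[symmetric])
    finally show ?thesis by (simp add: image_image)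
  qed
  then show ?thesis
    using pre[of "\<lambda>y. y > 0"] pre[of "\<lambda>y. y \<ge> \<alpha>"] by (simp add: fuzzy_level_def)
qed

lemma fuzzy_affine_eq:
  assumes A: "fuzzy_number A"
  shows "fuzzy_affine A r q = (if q = 0 then indicator {r} else (\<lambda>x. A ((x - r) / q)))"
    (is "_ = ?B")
proof -
  have lev: "fuzzy_level ?B \<alpha> = (\<lambda>x. r + q * x) ` fuzzy_level A \<alpha>" if \<alpha>: "\<alpha> \<in> {0..1}" for \<alpha>
  proof (cases "q = 0")
    case True
    have "fuzzy_level A \<alpha> \<noteq> {}" using A \<alpha> unfolding fuzzy_number_def by fastforce
    moreover have "fuzzy_level ?B \<alpha> = {r}"
    proof -
      have "{x. indicator {r} x > (0::real)} = {r}" by (auto simp: indicator_def)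
      moreover have "{x. indicator {r} x \<ge> \<alpha>} = {r}" if "\<alpha> \<noteq> 0"
        using that \<alpha> by (auto simp: indicator_def split: if_splits)
      ultimately show ?thesis using True by (simp add: fuzzy_level_def)
    qed
    ultimately show ?thesis using True by auto
  next
    case False
    then show ?thesis by (simp add: fuzzy_level_affine)
  qed
  have B: "fuzzy_number ?B"
    unfolding fuzzy_number_def
  proof (intro conjI ballI allI)
    show "?B x \<in> {0..1}" for x
      using A by (auto simp: fuzzy_number_def indicator_def)
  next
    fix \<alpha> :: real assume \<alpha>: "\<alpha> \<in> {0..1}"
    obtain c d where cd: "c \<le> d" "fuzzy_level A \<alpha> = {c..d}"
      using A \<alpha> unfolding fuzzy_number_def by blast
    have "(\<lambda>x. r + q * x) ` {c..d} =
        (if q \<ge> 0 then {r + q * c..r + q * d} else {r + q * d..r + q * c})"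
      using cd(1) image_affinity_atLeastAtMost[of q r c d]
      by (auto simp: add.commute)
    then have "\<exists>c' d'. c' \<le> d' \<and> (\<lambda>x. r + q * x) ` {c..d} = {c'..d'}"
      using cd(1) by (metis (no_types, lifting) atLeastatMost_empty_iff image_is_empty)
    then show "\<exists>c d. c \<le> d \<and> fuzzy_level ?B \<alpha> = {c..d}"
      using lev[OF \<alpha>] cd(2) by simp
  next
    have "bounded {x. A x > 0}" using A by (simp add: fuzzy_number_def)
    then have "bounded (closure {x. A x > 0})" by (rule bounded_closure)
    then have "bounded ((\<lambda>x. r + q * x) ` fuzzy_level A 0)"
      using bounded_translation[of "(*\<^sub>R) q ` closure {x. A x > 0}" r]
        bounded_scaling[of "closure {x. A x > 0}" q]
      by (simp add: fuzzy_level_def image_image)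
    then have "bounded (fuzzy_level ?B 0)" using lev[of 0] by simp
    moreover have "{x. ?B x > 0} \<subseteq> fuzzy_level ?B 0"
      unfolding fuzzy_level_def by (simp only: if_True refl closure_subset)
    ultimately show "bounded {x. ?B x > 0}" by (rule bounded_subset)
  qed
  show ?thesis
    unfolding fuzzy_affine_def
    by (rule the_equality) (use B lev in \<open>auto intro!: fuzzy_number_eqI\<close>)
qed

lemma asymmetric_not_indicator:
  assumes "asymmetric_fuzzy A" shows "A \<noteq> indicator {z}"
proof
  assume "A = indicator {z}"
  moreover obtain y where "A (z - y) \<noteq> A (z + y)"
    using assms unfolding asymmetric_fuzzy_def by blast
  ultimately show False by (auto simp: indicator_def split: if_splits)
qed

lemma fuzzy_affine_inject:
  assumes A: "fuzzy_number A" and as: "asymmetric_fuzzy A"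
    and eq: "fuzzy_affine A r q = fuzzy_affine A r' q'"
  shows "r = r' \<and> q = q'"
proof -
  have deg: False
    if "indicator {s} = (\<lambda>x. A ((x - t) / p))" "p \<noteq> 0" for s t p
  proof -
    have "A x = indicator {(s - t) / p} x" for x
    proof -
      have "A x = indicator {s} (t + p * x)"
        using fun_cong[OF that(1), of "t + p * x"] that(2) by simp
      then show ?thesis using that(2) by (auto simp: indicator_def field_simps)
    qed
    then show False using asymmetric_not_indicator[OF as] by blast
  qed
  consider "q = 0" "q' = 0" | "q = 0" "q' \<noteq> 0" | "q \<noteq> 0" "q' = 0" | "q \<noteq> 0" "q' \<noteq> 0" by blast
  then show ?thesis
  proof cases
    case 1
    then have "indicator {r} r = (indicator {r'} r :: real)"
      using fun_cong[OF eq, of r] by (simp add: fuzzy_affine_eq[OF A])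
    then show ?thesis using 1 by (auto simp: indicator_def split: if_splits)
  next
    case 2
    then show ?thesis using eq deg by (simp add: fuzzy_affine_eq[OF A])
  next
    case 3
    then show ?thesis using eq[symmetric] deg by (simp add: fuzzy_affine_eq[OF A])
  next
    case 4
    have levels: "(\<lambda>x. r + q * x) ` fuzzy_level A \<alpha> = (\<lambda>x. r' + q' * x) ` fuzzy_level A \<alpha>"
      for \<alpha>
      using eq 4 fuzzy_level_affine[of q A r \<alpha>] fuzzy_level_affine[of q' A r' \<alpha>]
      by (simp add: fuzzy_affine_eq[OF A])
    have "(0::real) \<in> {0..1}" by simp
    then obtain c d where cd: "c \<le> d" "fuzzy_level A 0 = {c..d}"
      using A unfolding fuzzy_number_def by blast
    have img: "(\<lambda>x. s + p * x) ` {c..d} =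
        (if p \<ge> 0 then {s + p * c..s + p * d} else {s + p * d..s + p * c})" for s p
      using cd(1) image_affinity_atLeastAtMost[of p s c d] by (auto simp: add.commute)
    have le: "p < 0 \<Longrightarrow> p * d \<le> p * c" "p \<ge> 0 \<Longrightarrow> p * c \<le> p * d" for p
      using cd(1) by (auto intro: mult_left_mono mult_left_mono_neg)
    have *: "(if q \<ge> 0 then {r + q * c..r + q * d} else {r + q * d..r + q * c}) =
       (if q' \<ge> 0 then {r' + q' * c..r' + q' * d} else {r' + q' * d..r' + q' * c})"
      using levels[of 0] unfolding cd(2) img by simp
    have "c \<noteq> d"
    proof
      assume "c = d"
      have "A x = 0" if "x \<noteq> c" for x
      proof -
        have "x \<notin> closure {x. A x > 0}" using cd(2) that \<open>c = d\<close> by (simp add: fuzzy_level_def)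
        then have "\<not> A x > 0" using closure_subset[of "{x. A x > 0}"] by auto
        moreover have "A x \<ge> 0" using A by (simp add: fuzzy_number_def)
        ultimately show ?thesis by simp
      qed
      moreover obtain y where "A (c - y) \<noteq> A (c + y)"
        using as unfolding asymmetric_fuzzy_def by blast
      ultimately show False by (cases "y = 0") auto
    qed
    have fe: "A ((x - r) / q) = A ((x - r') / q')" for x
      using fun_cong[OF eq, of x] 4 by (simp add: fuzzy_affine_eq[OF A])
    have "(q = q' \<and> r = r') \<or> (q' = - q \<and> r' = r + q * (c + d))"
    proof -
      have "c < d" using cd \<open>c \<noteq> d\<close> by simp
      have len: "\<bar>q\<bar> * (d - c) = \<bar>q'\<bar> * (d - c)"
        using * le[of q] le[of q'] by (auto simp: Icc_eq_Icc algebra_simps split: if_splits)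
      then have "\<bar>q\<bar> = \<bar>q'\<bar>" using \<open>c < d\<close> by simp
      then consider "q' = q" | "q' = - q" by (metis abs_eq_iff)
      then show ?thesis
        using * le[of q] le[of q'] by cases (auto simp: Icc_eq_Icc algebra_simps split: if_splits)
    qed
    then show ?thesis
    proof
      assume h: "q' = - q \<and> r' = r + q * (c + d)"
      have "A ((c + d) / 2 + y) = A ((c + d) / 2 - y)" for y
      proof -
        let ?x = "r + q * ((c + d) / 2 + y)"
        have "(?x - r) / q = (c + d) / 2 + y" using 4 by simp
        moreover have "(?x - r') / q' = (c + d) / 2 - y" using 4 h by (simp add: field_simps)
        ultimately show ?thesis using fe[of ?x] by simp
      qed
      then show ?thesis using as unfolding asymmetric_fuzzy_def by metis
    qed simp
  qed
qed

definition RF :: "(real \<Rightarrow> real) \<Rightarrow> (real \<Rightarrow> real) set" where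
  "RF A = {fuzzy_affine A r q | r q. True}"

text \<open>Inverse of (r, q) \<open>\<mapsto>\<close> r + q A; meaningful on \<open>RF A\<close> for asymmetric \<open>A\<close>.\<close>

definition RF_coords :: "(real \<Rightarrow> real) \<Rightarrow> (real \<Rightarrow> real) \<Rightarrow> real \<times> real" where
  "RF_coords A = inv (\<lambda>(r, q). fuzzy_affine A r q)"

lemma RF_coords_affine:
  assumes "fuzzy_number A" "asymmetric_fuzzy A"
  shows "RF_coords A (fuzzy_affine A r q) = (r, q)"
proof -
  have "inj (\<lambda>(r, q). fuzzy_affine A r q)"
    using fuzzy_affine_inject[OF assms] by (auto simp: inj_on_def)
  from inv_f_f[OF this, of "(r, q)"] show ?thesis by (simp add: RF_coords_def)
qed

definition RF_zero :: "(real \<Rightarrow> real) \<Rightarrow> (real \<Rightarrow> real)" where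
  "RF_zero A = fuzzy_affine A 0 0"

definition RF_add :: "(real \<Rightarrow> real) \<Rightarrow> (real \<Rightarrow> real) \<Rightarrow> (real \<Rightarrow> real) \<Rightarrow> (real \<Rightarrow> real)" where
  "RF_add A B C = fuzzy_affine A (fst (RF_coords A B) + fst (RF_coords A C))
                                 (snd (RF_coords A B) + snd (RF_coords A C))"

definition RF_scale :: "(real \<Rightarrow> real) \<Rightarrow> real \<Rightarrow> (real \<Rightarrow> real) \<Rightarrow> (real \<Rightarrow> real)" where
  "RF_scale A c B = fuzzy_affine A (c * fst (RF_coords A B)) (c * snd (RF_coords A B))"

definition RF_diff :: "(real \<Rightarrow> real) \<Rightarrow> (real \<Rightarrow> real) \<Rightarrow> (real \<Rightarrow> real) \<Rightarrow> (real \<Rightarrow> real)" where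
  "RF_diff A B C = RF_add A B (RF_scale A (-1) C)"

text \<open>The element b with \<open>[B]\<^sub>1 = {b}\<close>, whenever that level is a singleton.\<close>

definition fuzzy_core :: "(real \<Rightarrow> real) \<Rightarrow> real" where
  "fuzzy_core B = the_elem (fuzzy_level B 1)"

definition RF_norm :: "(real \<Rightarrow> real) \<Rightarrow> (real \<Rightarrow> real) \<Rightarrow> real" where
  "RF_norm A B = \<bar>snd (RF_coords A B)\<bar> +
                 \<bar>fst (RF_coords A B) + snd (RF_coords A B) * fuzzy_core A\<bar>"

definition RF_cross :: "(real \<Rightarrow> real) \<Rightarrow> (real \<Rightarrow> real) \<Rightarrow> (real \<Rightarrow> real) \<Rightarrow> (real \<Rightarrow> real)" where
  "RF_cross A B C =
     RF_add A (RF_add A (RF_scale A (fuzzy_core C) B) (RF_scale A (fuzzy_core B) C))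
              (fuzzy_affine A (- (fuzzy_core B * fuzzy_core C)) 0)"

definition RF_null :: "(real \<Rightarrow> real) \<Rightarrow> (real \<Rightarrow> real) set" where
  "RF_null A = {B \<in> RF A. RF_cross A B B = RF_zero A}"

lemma fuzzy_core_affine:
  assumes "fuzzy_number A" "fuzzy_level A 1 = {m}"
  shows "fuzzy_core (fuzzy_affine A r q) = r + q * m"
proof -
  have "A x = 1 \<longleftrightarrow> x = m" for x
  proof -
    have "A x \<le> 1" using assms(1) by (simp add: fuzzy_number_def)
    moreover have "A x \<ge> 1 \<longleftrightarrow> x = m" using assms(2) by (auto simp: fuzzy_level_def)
    ultimately show ?thesis by linarith
  qed
  moreover have "A x \<le> 1" for x using assms(1) by (simp add: fuzzy_number_def)
  ultimately have "1 \<le> A x \<longleftrightarrow> x = m" for x by (metis order.antisym order.refl)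
  then have "fuzzy_level (fuzzy_affine A r q) 1 = {r + q * m}"
    by (auto simp: fuzzy_level_def fuzzy_affine_eq[OF assms(1)] indicator_def field_simps
             split: if_splits)
  then show ?thesis by (simp add: fuzzy_core_def)
qed

lemma RF_cross_affine:
  assumes "fuzzy_number A" "asymmetric_fuzzy A" "fuzzy_level A 1 = {m}"
  shows "RF_cross A (fuzzy_affine A r q) (fuzzy_affine A s p) =
    fuzzy_affine A (r * s - m\<^sup>2 * q * p) (r * p + s * q + 2 * m * q * p)"
  by (simp add: RF_cross_def RF_add_def RF_scale_def RF_coords_affine[OF assms(1,2)]
      fuzzy_core_affine[OF assms(1,3)] algebra_simps power2_eq_square)

lemma RF_null_eq:
  assumes "fuzzy_number A" "asymmetric_fuzzy A" "fuzzy_level A 1 = {m}"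
  shows "RF_null A = {fuzzy_affine A r q | r q. r + q * m = 0}"
proof -
  have "RF_cross A (fuzzy_affine A r q) (fuzzy_affine A r q) = RF_zero A \<longleftrightarrow> r + q * m = 0"
    (is "?L \<longleftrightarrow> _") for r q
  proof -
    have "?L \<longleftrightarrow> r * r - m\<^sup>2 * q * q = 0 \<and> r * q + r * q + 2 * m * q * q = 0"
      unfolding RF_cross_affine[OF assms] RF_zero_def
      by (metis fuzzy_affine_inject[OF assms(1,2)])
    also have "\<dots> \<longleftrightarrow> r + q * m = 0"
    proof
      assume h: "r * r - m\<^sup>2 * q * q = 0 \<and> r * q + r * q + 2 * m * q * q = 0"
      then have "(r + q * m) * (r + q * m) = 0" by algebra
      then show "r + q * m = 0" by simp
    next
      assume "r + q * m = 0"
      then have "r = - (q * m)" by simp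
      then show "r * r - m\<^sup>2 * q * q = 0 \<and> r * q + r * q + 2 * m * q * q = 0"
        by (simp add: power2_eq_square)
    qed
    finally show ?thesis .
  qed
  then show ?thesis by (auto simp: RF_null_def RF_def)
qed

text \<open>A Riemann sum; the fold over \<open>RF_add\<close> is the finite vector sum in \<open>RF A\<close>.\<close>

definition RF_riemann_sum ::
  "(real \<Rightarrow> real) \<Rightarrow> (real \<Rightarrow> real \<Rightarrow> real) \<Rightarrow> (real \<times> real set) set \<Rightarrow> (real \<Rightarrow> real)" where
  "RF_riemann_sum A f \<D> =
     Finite_Set.fold (\<lambda>(x, K). RF_add A (RF_scale A (measure lborel K) (f x))) (RF_zero A) \<D>"

lemma RF_riemann_sum_eq:
  assumes "fuzzy_number A" "asymmetric_fuzzy A" "finite \<D>"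
  shows "RF_riemann_sum A f \<D> =
    fuzzy_affine A (\<Sum>(x, K)\<in>\<D>. measure lborel K * fst (RF_coords A (f x)))
                   (\<Sum>(x, K)\<in>\<D>. measure lborel K * snd (RF_coords A (f x)))"
proof -
  interpret comp_fun_commute "\<lambda>(x, K). RF_add A (RF_scale A (measure lborel K) (f x))"
    by standard
      (auto simp: fun_eq_iff RF_add_def RF_scale_def RF_coords_affine[OF assms(1,2)] algebra_simps)
  show ?thesis
    using assms(3)
  proof induction
    case empty
    show ?case by (simp add: RF_riemann_sum_def RF_zero_def)
  next
    case (insert p F)
    obtain x K where p: "p = (x, K)" by (cases p)
    have "RF_riemann_sum A f (insert p F) =
        RF_add A (RF_scale A (measure lborel K) (f x)) (RF_riemann_sum A f F)"
      using insert.hyps by (simp add: RF_riemann_sum_def p)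
    then show ?case
      using insert by (simp add: p RF_add_def RF_scale_def RF_coords_affine[OF assms(1,2)])
  qed
qed

text \<open>The bound \<open>\<delta>\<close> on the lengths of the intervals is uniform, so this is the Riemann
  integral and not the gauge integral.\<close>

definition has_RF_integral ::
  "(real \<Rightarrow> real) \<Rightarrow> real \<Rightarrow> real \<Rightarrow> (real \<Rightarrow> real \<Rightarrow> real) \<Rightarrow> (real \<Rightarrow> real) \<Rightarrow> bool" where
  "has_RF_integral A a b f I \<longleftrightarrow> I \<in> RF A \<and>
     (\<forall>\<epsilon>>0. \<exists>\<delta>>0. \<forall>\<D>. \<D> tagged_division_of {a..b} \<and> (\<forall>(x, K)\<in>\<D>. measure lborel K < \<delta>)
        \<longrightarrow> RF_norm A (RF_diff A (RF_riemann_sum A f \<D>) I) < \<epsilon>)"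

definition RF_integrable ::
  "(real \<Rightarrow> real) \<Rightarrow> real \<Rightarrow> real \<Rightarrow> (real \<Rightarrow> real \<Rightarrow> real) \<Rightarrow> bool" where
  "RF_integrable A a b f \<longleftrightarrow> (\<exists>I. has_RF_integral A a b f I)"

definition RF_integral ::
  "(real \<Rightarrow> real) \<Rightarrow> real \<Rightarrow> real \<Rightarrow> (real \<Rightarrow> real \<Rightarrow> real) \<Rightarrow> (real \<Rightarrow> real)" where
  "RF_integral A a b f = (THE I. has_RF_integral A a b f I)"

definition RF_continuous_on ::
  "(real \<Rightarrow> real) \<Rightarrow> real \<Rightarrow> real \<Rightarrow> (real \<Rightarrow> real \<Rightarrow> real) \<Rightarrow> bool" where
  "RF_continuous_on A a b \<eta> \<longleftrightarrow> (\<forall>t\<in>{a..b}.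
     ((\<lambda>s. RF_norm A (RF_diff A (\<eta> s) (\<eta> t))) \<longlongrightarrow> 0) (at t within {a..b}))"

text \<open>Taking the limit within \<open>{a..b}\<close> gives the one-sided derivatives at the end points.\<close>

definition has_RF_derivative ::
  "(real \<Rightarrow> real) \<Rightarrow> real \<Rightarrow> real \<Rightarrow> (real \<Rightarrow> real \<Rightarrow> real) \<Rightarrow> (real \<Rightarrow> real) \<Rightarrow> real \<Rightarrow> bool" where
  "has_RF_derivative A a b \<eta> D t \<longleftrightarrow> D \<in> RF A \<and>
     ((\<lambda>s. RF_norm A (RF_diff A (RF_scale A (1 / (s - t)) (RF_diff A (\<eta> s) (\<eta> t))) D))
        \<longlongrightarrow> 0) (at t within {a..b})"

definition RF_deriv ::
  "(real \<Rightarrow> real) \<Rightarrow> real \<Rightarrow> real \<Rightarrow> (real \<Rightarrow> real \<Rightarrow> real) \<Rightarrow> (real \<Rightarrow> real \<Rightarrow> real)" where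
  "RF_deriv A a b \<eta> = (\<lambda>t. THE D. has_RF_derivative A a b \<eta> D t)"

definition RF_C ::
  "(real \<Rightarrow> real) \<Rightarrow> nat \<Rightarrow> real \<Rightarrow> real \<Rightarrow> (real \<Rightarrow> real \<Rightarrow> real) set" where
  "RF_C A l a b = {\<eta>. \<eta> \<in> {a..b} \<rightarrow> RF A \<and>
     (\<forall>j<l. \<forall>t\<in>{a..b}. \<exists>D. has_RF_derivative A a b ((RF_deriv A a b ^^ j) \<eta>) D t) \<and>
     RF_continuous_on A a b ((RF_deriv A a b ^^ l) \<eta>)}"

end

theory Submission
  imports Defs
begin

text \<open>
  Only one kind of test function is needed: \<open>\<eta> t = p t + 0 A\<close> for a real polynomial \<open>p\<close> whose
  derivatives of order at most \<open>l\<close> vanish at \<open>a\<close> and \<open>b\<close>. Multiplying by a real number with the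
  cross product is multiplication by a scalar, so for \<open>f = r + q A\<close> the integral of \<open>f \<odot> \<eta>\<close> is
  \<open>(\<integral> r p) + (\<integral> q p) A\<close>. If it is zero, both \<open>r\<close> and \<open>q\<close> are orthogonal to every such \<open>p\<close>; if it
  is merely null, the linear combination \<open>r + a\<^sub>m q\<close> is. Both parts of the theorem thus reduce
  to a real fundamental lemma of the calculus of variations
  (\<open>AE_linear_combination_zero_if_orthogonal\<close>): a combination of two Riemann integrable functions
  that is orthogonal to all these polynomials is zero almost everywhere.

  For the real lemma, every multiple of \<open>w\<close>, the \<open>(l + 1)\<close>-st power of \<open>(x - a) (b - x)\<close>, is an
  admissible \<open>p\<close>. The combination, call it \<open>g\<close>, is bounded and measurable, hence an almost
  everywhere limit of uniformly bounded polynomials \<open>P\<^sub>n\<close> (by approximation with continuous functions and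
  the Weierstrass theorem). Dominated convergence turns \<open>\<integral> g w P\<^sub>n = 0\<close> into
  \<open>\<integral> g\<^sup>2 w = 0\<close>, and \<open>w\<close> is positive inside the interval, so \<open>g = 0\<close> almost everywhere.

  The integral in \<open>RF A\<close> is a Riemann integral, so the product of \<open>r\<close> or \<open>q\<close> with a polynomial
  has to be shown integrable with a uniform bound on the mesh; otherwise the value of the integral
  of \<open>f \<odot> \<eta>\<close> would be unknown. This is \<open>has_Riemann_integral_mult_continuous\<close>, which rests on
  Henstock's lemma for constant gauges.
\<close>

section \<open>Riemann integrals as gauge integrals with constant gauges\<close>

text \<open>The Riemann integral as a gauge integral restricted to constant gauges. In this form the
results on the Henstock--Kurzweil integral that work with one given gauge, such as Henstock's
lemma, apply to it directly.\<close>

definition has_Riemann_integral :: "(real \<Rightarrow> real) \<Rightarrow> real \<Rightarrow> real \<Rightarrow> real \<Rightarrow> bool" where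
  "has_Riemann_integral f I a b \<longleftrightarrow>
     (\<forall>\<epsilon>>0. \<exists>\<delta>>0. \<forall>\<D>. \<D> tagged_division_of {a..b} \<and> (\<lambda>x. ball x \<delta>) fine \<D>
        \<longrightarrow> \<bar>(\<Sum>(x, K)\<in>\<D>. measure lborel K * f x) - I\<bar> < \<epsilon>)"

lemma has_Riemann_integral_imp_has_integral:
  assumes "has_Riemann_integral f I a b"
  shows "(f has_integral I) {a..b}"
  unfolding has_integral_real
proof (intro allI impI)
  fix e :: real assume "e > 0"
  then obtain \<delta> where "\<delta> > 0" and \<delta>: "\<And>\<D>. \<D> tagged_division_of {a..b} \<Longrightarrow> (\<lambda>x. ball x \<delta>) fine \<D>
        \<Longrightarrow> \<bar>(\<Sum>(x, K)\<in>\<D>. measure lborel K * f x) - I\<bar> < e"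
    using assms unfolding has_Riemann_integral_def by meson
  then show "\<exists>\<gamma>. gauge \<gamma> \<and> (\<forall>\<D>. \<D> tagged_division_of {a..b} \<and> \<gamma> fine \<D> \<longrightarrow>
      norm ((\<Sum>(x, k)\<in>\<D>. measure lborel k *\<^sub>R f x) - I) < e)"
    by (intro exI[of _ "\<lambda>x. ball x \<delta>"]) (auto simp: split_def)
qed

text \<open>Henstock's lemma keeps the gauge it is given, so for a Riemann integral the same constant
gauge controls the error summed over all pieces of a partial division.\<close>

lemma Riemann_integral_Henstock:
  assumes f: "has_Riemann_integral f I a b" and "\<epsilon> > 0"
  shows "\<exists>\<delta>>0. \<forall>p. p tagged_partial_division_of {a..b} \<and> (\<lambda>x. ball x \<delta>) fine p
       \<longrightarrow> (\<Sum>(x, K)\<in>p. \<bar>measure lborel K * f x - integral K f\<bar>) \<le> \<epsilon>"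
proof -
  note int = has_Riemann_integral_imp_has_integral[OF f]
  obtain \<delta> where "\<delta> > 0" and \<delta>: "\<And>\<D>. \<D> tagged_division_of {a..b} \<Longrightarrow> (\<lambda>x. ball x \<delta>) fine \<D>
        \<Longrightarrow> \<bar>(\<Sum>(x, K)\<in>\<D>. measure lborel K * f x) - I\<bar> < \<epsilon> / 2"
    using f \<open>\<epsilon> > 0\<close> unfolding has_Riemann_integral_def by (meson half_gt_zero)
  show ?thesis
  proof (intro exI[of _ \<delta>] conjI allI impI)
    show "\<delta> > 0" by fact
    fix p assume p: "p tagged_partial_division_of {a..b} \<and> (\<lambda>x. ball x \<delta>) fine p"
    have "(\<Sum>(x, K)\<in>p. norm (measure lborel K *\<^sub>R f x - integral K f))
        \<le> 2 * real DIM(real) * (\<epsilon> / 2)"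
    proof (rule Henstock_lemma_part2[where d = "\<lambda>x. ball x \<delta>" and a = a and b = b])
      show "f integrable_on cbox a b" using int by auto
      show "gauge (\<lambda>x. ball x \<delta>)" using \<open>\<delta> > 0\<close> by blast
      show "norm ((\<Sum>(x, k)\<in>\<D>. measure lborel k *\<^sub>R f x) - integral (cbox a b) f) < \<epsilon> / 2"
        if "\<D> tagged_division_of cbox a b" "(\<lambda>x. ball x \<delta>) fine \<D>" for \<D>
        using \<delta>[of \<D>] that integral_unique[OF int] by (simp add: split_def)
    qed (use p \<open>\<epsilon> > 0\<close> in auto)
    then show "(\<Sum>(x, K)\<in>p. \<bar>measure lborel K * f x - integral K f\<bar>) \<le> \<epsilon>"
      by (simp add: split_def)
  qed
qed

text \<open>A single tagged interval of a fixed length \<open>h\<close> is already a fine partial division, so by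
Henstock's lemma \<open>h f(x)\<close> differs by at most 1 from the integral of \<open>f\<close> over an interval of
length \<open>h\<close> around \<open>x\<close>. That integral is a difference of values of the indefinite integral,
which is continuous and hence bounded.\<close>

lemma has_Riemann_integral_bounded:
  assumes f: "has_Riemann_integral f I a b" and "a < b"
  shows "\<exists>B>0. \<forall>x\<in>{a..b}. \<bar>f x\<bar> \<le> B"
proof -
  have int: "f integrable_on {a..b}"
    using has_Riemann_integral_imp_has_integral[OF f] by blast
  obtain \<delta> where "\<delta> > 0" and \<delta>: "\<And>p. p tagged_partial_division_of {a..b} \<Longrightarrow>
      (\<lambda>x. ball x \<delta>) fine p \<Longrightarrow> (\<Sum>(x, K)\<in>p. \<bar>measure lborel K * f x - integral K f\<bar>) \<le> 1"
    using Riemann_integral_Henstock[OF f zero_less_one] by blast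
  have "compact ((\<lambda>x. integral {a..x} f) ` {a..b})"
    by (intro compact_continuous_image indefinite_integral_continuous_1 int) simp
  then obtain C where C: "\<And>x. x \<in> {a..b} \<Longrightarrow> \<bar>integral {a..x} f\<bar> \<le> C"
    by (metis (no_types, lifting) bounded_iff compact_imp_bounded imageI real_norm_def)
  have C0: "C \<ge> 0" using C[of a] \<open>a < b\<close> by auto
  define h where "h = min (\<delta> / 2) ((b - a) / 2)"
  have h: "h > 0" "h < \<delta>" "h \<le> (b - a) / 2" using \<open>\<delta> > 0\<close> \<open>a < b\<close> by (auto simp: h_def min_def)
  have "\<bar>f x\<bar> \<le> (1 + 2 * C) / h" if x: "x \<in> {a..b}" for x
  proof -
    \<comment> \<open>The interval of length \<open>h\<close> goes to the right of a tag in the left half and to the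
      left otherwise, to stay inside \<open>{a..b}\<close>.\<close>
    define u where "u = (if x \<le> (a + b) / 2 then x else x - h)"
    have u: "a \<le> u" "u + h \<le> b" "x \<in> {u..u + h}"
      using h x unfolding u_def by (auto simp: field_simps split: if_splits)
    have "{(x, {u..u + h})} tagged_partial_division_of {a..b}"
      unfolding tagged_partial_division_of_def
      using u by (auto intro!: exI[of _ u] exI[of _ "u + h"])
    moreover have "(\<lambda>x. ball x \<delta>) fine {(x, {u..u + h})}"
      using u(3) h by (auto simp: fine_def dist_real_def)
    ultimately have "\<bar>h * f x - integral {u..u + h} f\<bar> \<le> 1"
      using \<delta> h by force
    moreover have "integral {a..u} f + integral {u..u + h} f = integral {a..u + h} f"
      using u h by (intro Henstock_Kurzweil_Integration.integral_combine
          integrable_subinterval_real[OF int]) auto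
    moreover have "\<bar>integral {a..u} f\<bar> \<le> C" "\<bar>integral {a..u + h} f\<bar> \<le> C"
      using u h by (auto intro!: C)
    ultimately have "\<bar>h * f x\<bar> \<le> 1 + 2 * C" by linarith
    then show ?thesis using h by (simp add: abs_mult field_simps)
  qed
  moreover have "(1 + 2 * C) / h > 0" using C0 h by simp
  ultimately show ?thesis by blast
qed

lemma has_Riemann_integral_absolutely_integrable:
  assumes f: "has_Riemann_integral f I a b" and "a < b"
  shows "f absolutely_integrable_on {a..b}"
proof -
  obtain B where "\<And>x. x \<in> {a..b} \<Longrightarrow> \<bar>f x\<bar> \<le> B"
    using has_Riemann_integral_bounded[OF assms] by blast
  then show ?thesis
    using has_Riemann_integral_imp_has_integral[OF f]
    by (intro absolutely_integrable_integrable_bound[where g = "\<lambda>_. B"]) auto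
qed

text \<open>On a piece \<open>K\<close> with tag \<open>x\<close>, the error of the product splits into \<open>g(x)\<close> times the error of \<open>f\<close>,
which Henstock's lemma controls after summation, and the integral of \<open>(g(x) - g) f\<close> over \<open>K\<close>, which
is small by uniform continuity of \<open>g\<close> and boundedness of \<open>f\<close>.\<close>

lemma has_Riemann_integral_mult_continuous:
  assumes f: "has_Riemann_integral f I a b" and "a < b" and g: "continuous_on {a..b} g"
  shows "has_Riemann_integral (\<lambda>x. f x * g x) (integral {a..b} (\<lambda>x. f x * g x)) a b"
  unfolding has_Riemann_integral_def
proof (intro allI impI)
  fix \<epsilon> :: real assume "\<epsilon> > 0"
  obtain B where B: "B > 0" "\<And>x. x \<in> {a..b} \<Longrightarrow> \<bar>f x\<bar> \<le> B"
    using has_Riemann_integral_bounded[OF assms(1,2)] by blast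
  have gbdd: "bounded (g ` {a..b})"
    by (intro compact_imp_bounded compact_continuous_image g) simp
  then obtain G where G: "G > 0" "\<And>x. x \<in> {a..b} \<Longrightarrow> \<bar>g x\<bar> \<le> G"
    by (metis bounded_pos imageI real_norm_def)
  have int: "f integrable_on {a..b}"
    using has_Riemann_integral_imp_has_integral[OF f] by blast
  have "(\<lambda>x. g x * f x) absolutely_integrable_on {a..b}"
    using g gbdd has_Riemann_integral_absolutely_integrable[OF f \<open>a < b\<close>]
    by (intro absolutely_integrable_bounded_measurable_product_real
        continuous_imp_measurable_on_sets_lebesgue) auto
  then have intfg: "(\<lambda>x. f x * g x) integrable_on {a..b}"
    by (simp add: set_lebesgue_integral_eq_integral mult.commute)
  \<comment> \<open>Each of the two errors is allowed a third of \<open>\<epsilon>\<close>.\<close>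
  define \<epsilon>1 where "\<epsilon>1 = \<epsilon> / (3 * G)"
  define \<epsilon>2 where "\<epsilon>2 = \<epsilon> / (3 * B * (b - a))"
  have pos: "\<epsilon>1 > 0" "\<epsilon>2 > 0" using \<open>\<epsilon> > 0\<close> B G \<open>a < b\<close> by (auto simp: \<epsilon>1_def \<epsilon>2_def)
  obtain \<delta>1 where "\<delta>1 > 0" and \<delta>1: "\<And>p. p tagged_partial_division_of {a..b} \<Longrightarrow>
      (\<lambda>x. ball x \<delta>1) fine p \<Longrightarrow> (\<Sum>(x, K)\<in>p. \<bar>measure lborel K * f x - integral K f\<bar>) \<le> \<epsilon>1"
    using Riemann_integral_Henstock[OF f pos(1)] by blast
  have "uniformly_continuous_on {a..b} g"
    by (rule compact_uniformly_continuous[OF g]) simp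
  then obtain \<delta>2 where "\<delta>2 > 0" and
    \<delta>2: "\<And>x y. x \<in> {a..b} \<Longrightarrow> y \<in> {a..b} \<Longrightarrow> dist y x < \<delta>2 \<Longrightarrow> dist (g y) (g x) < \<epsilon>2"
    using pos(2) unfolding uniformly_continuous_on_def by metis
  show "\<exists>\<delta>>0. \<forall>\<D>. \<D> tagged_division_of {a..b} \<and> (\<lambda>x. ball x \<delta>) fine \<D> \<longrightarrow>
      \<bar>(\<Sum>(x, K)\<in>\<D>. measure lborel K * (f x * g x)) - integral {a..b} (\<lambda>x. f x * g x)\<bar> < \<epsilon>"
  proof (intro exI[of _ "min \<delta>1 \<delta>2"] conjI allI impI)
    show "min \<delta>1 \<delta>2 > 0" using \<open>\<delta>1 > 0\<close> \<open>\<delta>2 > 0\<close> by simp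
    fix \<D> assume "\<D> tagged_division_of {a..b} \<and> (\<lambda>x. ball x (min \<delta>1 \<delta>2)) fine \<D>"
    then have \<D>: "\<D> tagged_division_of {a..b}" and fine: "(\<lambda>x. ball x (min \<delta>1 \<delta>2)) fine \<D>"
      by auto
    have \<D>c: "\<D> tagged_division_of cbox a b" using \<D> by simp
    have local_bound: "\<bar>measure lborel K * (f x * g x) - integral K (\<lambda>x. f x * g x)\<bar>
        \<le> G * \<bar>measure lborel K * f x - integral K f\<bar> + \<epsilon>2 * B * measure lborel K"
      if xK: "(x, K) \<in> \<D>" for x K
    proof -
      obtain u v where K: "K = cbox u v" using tagged_division_ofD(4)[OF \<D> xK] by blast
      have Kab: "K \<subseteq> {a..b}" and "x \<in> K" using \<D> xK by auto
      then have x: "x \<in> {a..b}" by auto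
      have intK: "f integrable_on K" "(\<lambda>x. f x * g x) integrable_on K"
        using Kab integrable_subinterval_real[OF int, of u v]
          integrable_subinterval_real[OF intfg, of u v] unfolding K by simp_all
      have int2: "((\<lambda>y. g x * f y - f y * g y) has_integral
          (g x * integral K f - integral K (\<lambda>x. f x * g x))) K"
        by (intro has_integral_diff has_integral_mult_right integrable_integral intK)
      have "\<bar>g x * integral K f - integral K (\<lambda>x. f x * g x)\<bar> \<le> \<epsilon>2 * B * measure lborel K"
        unfolding K
      proof (rule has_integral_bound[OF _ int2[unfolded K], unfolded real_norm_def])
        show "0 \<le> \<epsilon>2 * B" using pos B by simp
        fix y assume "y \<in> cbox u v"
        moreover have "K \<subseteq> ball x (min \<delta>1 \<delta>2)" using fine xK by (auto simp: fine_def)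
        ultimately have y: "y \<in> {a..b}" "dist y x < \<delta>2"
          using K Kab by (auto simp: dist_commute)
        have "\<bar>g x * f y - f y * g y\<bar> = \<bar>g y - g x\<bar> * \<bar>f y\<bar>"
          by (simp add: abs_mult[symmetric] algebra_simps abs_minus_commute)
        also have "\<dots> \<le> \<epsilon>2 * B"
          using \<delta>2[OF x y] B(2)[OF y(1)] pos by (intro mult_mono) (auto simp: dist_real_def)
        finally show "\<bar>g x * f y - f y * g y\<bar> \<le> \<epsilon>2 * B" .
      qed
      moreover have "\<bar>g x * (measure lborel K * f x - integral K f)\<bar>
          \<le> G * \<bar>measure lborel K * f x - integral K f\<bar>"
        unfolding abs_mult by (intro mult_right_mono G(2) x) simp
      moreover have "measure lborel K * (f x * g x) - integral K (\<lambda>x. f x * g x) =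
          g x * (measure lborel K * f x - integral K f) +
          (g x * integral K f - integral K (\<lambda>x. f x * g x))"
        by (simp add: algebra_simps)
      ultimately show ?thesis by linarith
    qed
    have "integral {a..b} (\<lambda>x. f x * g x) = (\<Sum>(x, K)\<in>\<D>. integral K (\<lambda>x. f x * g x))"
      using integral_combine_tagged_division_topdown[OF _ \<D>c] intfg by simp
    then have "\<bar>(\<Sum>(x, K)\<in>\<D>. measure lborel K * (f x * g x)) - integral {a..b} (\<lambda>x. f x * g x)\<bar>
        = \<bar>\<Sum>(x, K)\<in>\<D>. measure lborel K * (f x * g x) - integral K (\<lambda>x. f x * g x)\<bar>"
      by (simp add: split_def sum_subtractf)
    also have "\<dots> \<le> (\<Sum>(x, K)\<in>\<D>. \<bar>measure lborel K * (f x * g x) - integral K (\<lambda>x. f x * g x)\<bar>)"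
      unfolding split_def by (rule sum_abs)
    also have "\<dots> \<le> (\<Sum>(x, K)\<in>\<D>. G * \<bar>measure lborel K * f x - integral K f\<bar> + \<epsilon>2 * B * measure lborel K)"
      using local_bound by (intro sum_mono) auto
    also have "\<dots> = G * (\<Sum>(x, K)\<in>\<D>. \<bar>measure lborel K * f x - integral K f\<bar>)
        + \<epsilon>2 * B * (\<Sum>(x, K)\<in>\<D>. measure lborel K)"
      by (simp add: split_def sum.distrib sum_distrib_left)
    also have "(\<Sum>(x, K)\<in>\<D>. measure lborel K) = b - a"
      using additive_content_tagged_division[OF \<D>c] \<open>a < b\<close> by simp
    also have "G * (\<Sum>(x, K)\<in>\<D>. \<bar>measure lborel K * f x - integral K f\<bar>) \<le> G * \<epsilon>1"
    proof (intro mult_left_mono \<delta>1)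
      show "\<D> tagged_partial_division_of {a..b}" using \<D> by (simp add: tagged_division_of_def)
      show "(\<lambda>x. ball x \<delta>1) fine \<D>" using fine by (fastforce simp: fine_def)
    qed (use G in simp)
    also have "G * \<epsilon>1 + \<epsilon>2 * B * (b - a) = 2 * \<epsilon> / 3"
      using B G \<open>a < b\<close> by (simp add: \<epsilon>1_def \<epsilon>2_def field_simps)
    also have "\<dots> < \<epsilon>" using \<open>\<epsilon> > 0\<close> by simp
    finally show "\<bar>(\<Sum>(x, K)\<in>\<D>. measure lborel K * (f x * g x)) - integral {a..b} (\<lambda>x. f x * g x)\<bar> < \<epsilon>"
      by simp
  qed
qed

section \<open>Functions orthogonal to polynomials\<close>

text \<open>A measurable function is an almost everywhere limit of continuous functions. Cutting these off
at the bound of \<open>f\<close> does not change the limit, and replacing the \<open>n\<close>-th one by a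
polynomial at uniform distance less than \<open>1/(n + 1)\<close> does not either.\<close>

lemma tendsto_polynomials_AE:
  fixes f :: "real \<Rightarrow> real"
  assumes f: "f \<in> borel_measurable (lebesgue_on {a..b})"
    and B: "\<And>x. x \<in> {a..b} \<Longrightarrow> \<bar>f x\<bar> \<le> B"
  obtains P :: "nat \<Rightarrow> real poly"
  where "\<And>n x. x \<in> {a..b} \<Longrightarrow> \<bar>poly (P n) x\<bar> \<le> \<bar>B\<bar> + 1"
    and "AE x in lebesgue_on {a..b}. (\<lambda>n. poly (P n) x) \<longlonglongrightarrow> f x"
proof -
  have "f measurable_on {a..b}"
    using f by (simp add: measurable_on_iff_borel_measurable)
  then obtain N g where N: "negligible N" and g: "\<And>n::nat. continuous_on UNIV (g n)"
    and lim: "\<And>x. x \<notin> N \<Longrightarrow> (\<lambda>n. g n x) \<longlonglongrightarrow> (if x \<in> {a..b} then f x else 0)"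
    unfolding measurable_on_def by blast
  define c where "c n x = max (- \<bar>B\<bar>) (min \<bar>B\<bar> (g n x))" for n x
  have "\<exists>p. \<forall>x\<in>{a..b}. \<bar>c n x - poly p x\<bar> < 1 / Suc n" for n
  proof -
    have "continuous_on {a..b} (c n)"
      unfolding c_def by (intro continuous_intros continuous_on_subset[OF g]) auto
    then obtain h where "real_polynomial_function h"
      "\<And>x. x \<in> {a..b} \<Longrightarrow> \<bar>c n x - h x\<bar> < 1 / Suc n"
      using Stone_Weierstrass_real_polynomial_function[of "{a..b}" "c n" "1 / Suc n"] by auto
    moreover from this(1) obtain d k where "h = (\<lambda>x. \<Sum>i\<le>k. d i * x ^ i)"
      unfolding real_polynomial_function_iff_sum by blast
    then have "h x = poly (\<Sum>i\<le>k. monom (d i) i) x" for x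
      by (simp add: poly_sum poly_monom)
    ultimately show ?thesis by metis
  qed
  then obtain P where P: "\<And>n x. x \<in> {a..b} \<Longrightarrow> \<bar>c n x - poly (P n) x\<bar> < 1 / Suc n"
    by metis
  show thesis
  proof
    fix n x assume "x \<in> {a..b}"
    moreover have "\<bar>c n x\<bar> \<le> \<bar>B\<bar>" by (auto simp: c_def)
    moreover have "1 / real (Suc n) \<le> 1" by simp
    ultimately show "\<bar>poly (P n) x\<bar> \<le> \<bar>B\<bar> + 1" using P[of x n] by linarith
  next
    have "(\<lambda>n. poly (P n) x) \<longlonglongrightarrow> f x" if x: "x \<in> {a..b}" "x \<notin> N" for x
    proof -
      have "(\<lambda>n. c n x) \<longlonglongrightarrow> max (- \<bar>B\<bar>) (min \<bar>B\<bar> (f x))"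
        unfolding c_def using lim[OF x(2)] x(1) by (intro tendsto_intros) auto
      also have "max (- \<bar>B\<bar>) (min \<bar>B\<bar> (f x)) = f x" using B[OF x(1)] by linarith
      finally have c: "(\<lambda>n. c n x) \<longlonglongrightarrow> f x" .
      have "(\<lambda>n. c n x - poly (P n) x) \<longlonglongrightarrow> 0"
        by (rule Lim_null_comparison[OF _ lim_1_over_n[THEN LIMSEQ_Suc]])
          (use P[OF x(1)] in \<open>auto intro!: always_eventually less_imp_le\<close>)
      from tendsto_diff[OF c this] show ?thesis by simp
    qed
    then have "AE x in lebesgue. x \<in> {a..b} \<longrightarrow> (\<lambda>n. poly (P n) x) \<longlonglongrightarrow> f x"
      unfolding eventually_ae_filter_negligible using N by blast
    then show "AE x in lebesgue_on {a..b}. (\<lambda>n. poly (P n) x) \<longlonglongrightarrow> f x"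
      by (simp add: AE_restrict_space_iff)
  qed
qed

text \<open>Approximating \<open>f\<close> itself by polynomials gives \<open>\<integral> f\<^sup>2 w = 0\<close> in the limit.\<close>

lemma AE_zero_if_orthogonal_to_weighted_polynomials:
  fixes f w :: "real \<Rightarrow> real"
  assumes f: "f \<in> borel_measurable (lebesgue_on {a..b})"
    and B: "\<And>x. x \<in> {a..b} \<Longrightarrow> \<bar>f x\<bar> \<le> B"
    and w: "continuous_on {a..b} w" "\<And>x. x \<in> {a..b} \<Longrightarrow> w x \<ge> 0"
    and Z: "finite {x \<in> {a..b}. w x = 0}"
    and orth: "\<And>p. integral {a..b} (\<lambda>x. f x * (w x * poly p x)) = 0"
  shows "AE x in lebesgue_on {a..b}. f x = 0"
proof -
  let ?M = "lebesgue_on {a..b}"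
  obtain P where P: "\<And>n x. x \<in> {a..b} \<Longrightarrow> \<bar>poly (P n) x\<bar> \<le> \<bar>B\<bar> + 1"
    and lim: "AE x in ?M. (\<lambda>n. poly (P n) x) \<longlonglongrightarrow> f x"
    using tendsto_polynomials_AE[OF f B] by metis
  have w_meas [measurable]: "w \<in> borel_measurable ?M"
    by (intro continuous_imp_measurable_on_sets_lebesgue w) auto
  have p_meas [measurable]: "poly p \<in> borel_measurable ?M" for p :: "real poly"
    by (intro continuous_imp_measurable_on_sets_lebesgue) (auto intro!: continuous_intros)
  note f [measurable]
  have "bounded (w ` {a..b})"
    by (intro compact_imp_bounded compact_continuous_image w) simp
  then obtain W where W: "\<And>x. x \<in> {a..b} \<Longrightarrow> \<bar>w x\<bar> \<le> W"
    by (metis bounded_iff imageI real_norm_def)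
  let ?C = "\<bar>B\<bar> * (W * (\<bar>B\<bar> + 1))"
  have bound: "\<bar>f x * (w x * y)\<bar> \<le> ?C" if "x \<in> {a..b}" "\<bar>y\<bar> \<le> \<bar>B\<bar> + 1" for x y
    unfolding abs_mult
    using B[OF that(1)] W[OF that(1)] that(2) by (intro mult_mono) auto
  have fin: "finite_measure ?M"
    by (rule finite_measure_lebesgue_on) simp
  have const: "integrable ?M (\<lambda>_. ?C)"
    by (simp add: fin finite_measure.integrable_const)
  have intp: "integrable ?M (\<lambda>x. f x * (w x * poly (P n) x))" for n
    by (rule Bochner_Integration.integrable_bound[OF const])
      (auto intro!: bound P order_trans[OF bound abs_ge_self])
  have intf: "integrable ?M (\<lambda>x. f x * (w x * f x))"
    by (rule Bochner_Integration.integrable_bound[OF const])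
      (auto intro!: order_trans[OF bound abs_ge_self] B[THEN order_trans])
  have "(\<lambda>n. integral\<^sup>L ?M (\<lambda>x. f x * (w x * poly (P n) x)))
      \<longlonglongrightarrow> integral\<^sup>L ?M (\<lambda>x. f x * (w x * f x))"
  proof (rule integral_dominated_convergence[OF _ _ const])
    show "AE x in ?M. (\<lambda>n. f x * (w x * poly (P n) x)) \<longlonglongrightarrow> f x * (w x * f x)"
      using lim by eventually_elim (intro tendsto_intros)
    show "AE x in ?M. norm (f x * (w x * poly (P n) x)) \<le> ?C" for n
      by (rule AE_I2) (auto intro!: bound P)
  qed measurable
  moreover have "integral\<^sup>L ?M (\<lambda>x. f x * (w x * poly (P n) x)) = 0" for n
    using orth intp by (simp add: lebesgue_integral_eq_integral)
  ultimately have "integral\<^sup>L ?M (\<lambda>x. f x * (w x * f x)) = 0"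
    by (simp add: LIMSEQ_const_iff)
  moreover have "f x * (w x * f x) \<ge> 0" if "x \<in> {a..b}" for x
    using w(2)[OF that] by (metis mult.left_commute mult_nonneg_nonneg zero_le_square)
  then have "AE x in ?M. f x * (w x * f x) \<ge> 0"
    by (intro AE_I2) simp
  ultimately have "AE x in ?M. f x * (w x * f x) = 0"
    using integral_nonneg_eq_0_iff_AE[OF intf] by blast
  moreover have "AE x in ?M. w x \<noteq> 0"
  proof -
    have "AE x in lebesgue. x \<in> {a..b} \<longrightarrow> w x \<noteq> 0"
      unfolding eventually_ae_filter_negligible
      using negligible_finite[OF Z] by blast
    then show ?thesis by (simp add: AE_restrict_space_iff)
  qed
  ultimately show ?thesis by eventually_elim auto
qed

text \<open>Each derivative costs one factor \<open>q\<close>: a polynomial divisible by a high power of \<open>q\<close> has many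
derivatives that still vanish at the zeros of \<open>q\<close>.\<close>

lemma power_dvd_pderiv:
  assumes "q ^ Suc n dvd p"
  shows "q ^ n dvd pderiv p"
proof -
  obtain s where "p = q ^ Suc n * s" using assms by (elim dvdE)
  then show ?thesis 
    by (auto simp: pderiv_mult pderiv_power_Suc simp del: power_Suc
        intro!: dvd_add dvd_smult dvd_mult2[OF le_imp_power_dvd])
qed

lemma power_dvd_iterate_pderiv: "q ^ (j + k) dvd p \<Longrightarrow> q ^ k dvd (pderiv ^^ j) p"
proof (induction j arbitrary: p)
  case (Suc j)
  then have "q ^ k dvd (pderiv ^^ j) (pderiv p)"
    by (intro Suc.IH power_dvd_pderiv) simp
  then show ?case by (simp add: funpow_swap1)
qed simp

text \<open>The multiples of the \<open>(l + 1)\<close>-st power of \<open>(x - a) (b - x)\<close> are admissible, and this weight is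
nonnegative on \<open>{a..b}\<close> with zeros only at the end points.\<close>

lemma AE_zero_if_orthogonal_to_flat_polynomials:
  fixes f :: "real \<Rightarrow> real"
  assumes f: "f \<in> borel_measurable (lebesgue_on {a..b})"
    and B: "\<And>x. x \<in> {a..b} \<Longrightarrow> \<bar>f x\<bar> \<le> B"
    and orth: "\<And>p. (\<And>j. j \<le> l \<Longrightarrow> poly ((pderiv ^^ j) p) a = 0 \<and> poly ((pderiv ^^ j) p) b = 0)
      \<Longrightarrow> integral {a..b} (\<lambda>x. f x * poly p x) = 0"
  shows "AE x in lebesgue_on {a..b}. f x = 0"
proof (rule AE_zero_if_orthogonal_to_weighted_polynomials[OF f B])
  let ?q = "[:- a, 1:] * [:b, - 1:] :: real poly"
  have q: "poly ?q x = (x - a) * (b - x)" for x by (simp add: algebra_simps)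
  let ?w = "\<lambda>x. poly (?q ^ Suc l) x"
  show "continuous_on {a..b} ?w" by (intro continuous_intros)
  show "?w x \<ge> 0" if "x \<in> {a..b}" for x
    unfolding poly_power q using that by simp
  have "{x \<in> {a..b}. ?w x = 0} \<subseteq> {a, b}"
    unfolding poly_power q by auto
  then show "finite {x \<in> {a..b}. ?w x = 0}" by (rule finite_subset) simp
  show "integral {a..b} (\<lambda>x. f x * (?w x * poly p x)) = 0" for p
  proof -
    have "?q dvd (pderiv ^^ j) (?q ^ Suc l * p)" if "j \<le> l" for j
    proof -
      have "?q ^ (j + 1) dvd ?q ^ Suc l * p"
        using that by (intro dvd_mult2 le_imp_power_dvd) simp
      then show ?thesis using power_dvd_iterate_pderiv by fastforce
    qed
    then have "poly ((pderiv ^^ j) (?q ^ Suc l * p)) x = 0" if "j \<le> l" "poly ?q x = 0" for j x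
      using that by (metis dvd_trans poly_eq_0_iff_dvd)
    then have "integral {a..b} (\<lambda>x. f x * poly (?q ^ Suc l * p) x) = 0"
      by (intro orth) (simp add: q)
    then show ?thesis by (simp only: poly_mult)
  qed
qed

text \<open>The coefficients \<open>(1, a\<^sub>m)\<close> serve the null set, the coefficients \<open>(1, 0)\<close> and \<open>(0, 1)\<close> the zero
vector.\<close>

lemma AE_linear_combination_zero_if_orthogonal:
  fixes r q :: "real \<Rightarrow> real" and \<alpha> \<beta> :: real
  assumes "a < b" and r: "has_Riemann_integral r I a b" and q: "has_Riemann_integral q J a b"
    and orth: "\<And>p. (\<And>j. j \<le> l \<Longrightarrow> poly ((pderiv ^^ j) p) a = 0 \<and> poly ((pderiv ^^ j) p) b = 0)
      \<Longrightarrow> \<alpha> * integral {a..b} (\<lambda>x. r x * poly p x) + \<beta> * integral {a..b} (\<lambda>x. q x * poly p x) = 0"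
  shows "AE x in lebesgue_on {a..b}. \<alpha> * r x + \<beta> * q x = 0"
proof -
  have meas: "h \<in> borel_measurable (lebesgue_on {a..b})" if "has_Riemann_integral h K a b" for h K
    using has_Riemann_integral_imp_has_integral[OF that] by (intro integrable_imp_measurable) auto
  have int: "(\<lambda>x. h x * poly p x) integrable_on {a..b}"
    if "has_Riemann_integral h K a b" for h K and p :: "real poly"
  proof -
    have "continuous_on {a..b} (poly p)" by (intro continuous_intros)
    from has_Riemann_integral_imp_has_integral[OF
        has_Riemann_integral_mult_continuous[OF that \<open>a < b\<close> this]]
    show ?thesis by blast
  qed
  obtain R where R: "\<And>x. x \<in> {a..b} \<Longrightarrow> \<bar>r x\<bar> \<le> R"
    using has_Riemann_integral_bounded[OF r \<open>a < b\<close>] by blast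
  obtain Q where Q: "\<And>x. x \<in> {a..b} \<Longrightarrow> \<bar>q x\<bar> \<le> Q"
    using has_Riemann_integral_bounded[OF q \<open>a < b\<close>] by blast
  show ?thesis
  proof (rule AE_zero_if_orthogonal_to_flat_polynomials)
    show "(\<lambda>x. \<alpha> * r x + \<beta> * q x) \<in> borel_measurable (lebesgue_on {a..b})"
      using meas[OF r] meas[OF q] by measurable
    show "\<bar>\<alpha> * r x + \<beta> * q x\<bar> \<le> \<bar>\<alpha>\<bar> * R + \<bar>\<beta>\<bar> * Q" if "x \<in> {a..b}" for x
    proof -
      have "\<bar>\<alpha> * r x\<bar> \<le> \<bar>\<alpha>\<bar> * R" "\<bar>\<beta> * q x\<bar> \<le> \<bar>\<beta>\<bar> * Q"
        unfolding abs_mult using R[OF that] Q[OF that] by (auto intro: mult_left_mono)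
      then show ?thesis by linarith
    qed
    fix p
    assume flat: "\<And>j. j \<le> l \<Longrightarrow> poly ((pderiv ^^ j) p) a = 0 \<and> poly ((pderiv ^^ j) p) b = 0"
    have "((\<lambda>x. \<alpha> * (r x * poly p x) + \<beta> * (q x * poly p x)) has_integral
        (\<alpha> * integral {a..b} (\<lambda>x. r x * poly p x) + \<beta> * integral {a..b} (\<lambda>x. q x * poly p x)))
        {a..b}"
      by (intro has_integral_add has_integral_mult_right integrable_integral int[OF r] int[OF q])
    then show "integral {a..b} (\<lambda>x. (\<alpha> * r x + \<beta> * q x) * poly p x) = 0"
      using orth[OF flat] by (auto simp: algebra_simps dest: integral_unique)
  qed
qed

section \<open>Calculus in coordinates of the fuzzy vector space\<close>

text \<open>The norm on \<open>RF A\<close> is equivalent to the sum of the absolute values of the coordinates. Hence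
limits, derivatives and integrals may be computed coordinatewise.\<close>

context
  fixes A :: "real \<Rightarrow> real" and m :: real
  assumes A: "fuzzy_number A" "asymmetric_fuzzy A" and m: "fuzzy_level A 1 = {m}"
begin

lemma RF_norm_affine: "RF_norm A (fuzzy_affine A r q) = \<bar>q\<bar> + \<bar>r + q * m\<bar>"
  using m by (simp add: RF_norm_def RF_coords_affine[OF A] fuzzy_core_def)

lemma abs_le_RF_norm_affine:
  "\<bar>r\<bar> \<le> (1 + \<bar>m\<bar>) * RF_norm A (fuzzy_affine A r q)"
  "\<bar>q\<bar> \<le> (1 + \<bar>m\<bar>) * RF_norm A (fuzzy_affine A r q)"
proof -
  let ?N = "RF_norm A (fuzzy_affine A r q)"
  have "\<bar>m\<bar> * ?N \<ge> \<bar>q * m\<bar>" "\<bar>m\<bar> * ?N \<ge> 0"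
    by (simp_all add: RF_norm_affine abs_mult algebra_simps)
  moreover have "?N \<ge> \<bar>q\<bar>" "?N \<ge> \<bar>r + q * m\<bar>"
    by (simp_all add: RF_norm_affine)
  ultimately show "\<bar>r\<bar> \<le> (1 + \<bar>m\<bar>) * ?N" "\<bar>q\<bar> \<le> (1 + \<bar>m\<bar>) * ?N"
    unfolding distrib_right mult_1 by linarith+
qed

lemma RF_norm_affine_le: "RF_norm A (fuzzy_affine A r q) \<le> (1 + \<bar>m\<bar>) * (\<bar>r\<bar> + \<bar>q\<bar>)"
proof -
  have "\<bar>r + q * m\<bar> \<le> \<bar>r\<bar> + \<bar>m\<bar> * \<bar>q\<bar>"
    using abs_triangle_ineq[of r "q * m"] by (simp add: abs_mult mult.commute)
  moreover have "0 \<le> \<bar>m\<bar> * \<bar>r\<bar>" by simp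
  ultimately show ?thesis
    unfolding RF_norm_affine distrib_right distrib_left mult_1 by linarith
qed

lemma tendsto_RF_norm_affine_0_iff:
  "((\<lambda>s. RF_norm A (fuzzy_affine A (r s) (q s))) \<longlongrightarrow> 0) F \<longleftrightarrow>
     (r \<longlongrightarrow> 0) F \<and> (q \<longlongrightarrow> 0) F" (is "?L \<longleftrightarrow> ?R")
proof
  assume ?L
  from tendsto_mult_left[OF this, of "1 + \<bar>m\<bar>"]
  have lim: "((\<lambda>s. (1 + \<bar>m\<bar>) * RF_norm A (fuzzy_affine A (r s) (q s))) \<longlongrightarrow> 0) F" by simp
  show ?R
    by (intro conjI Lim_null_comparison[OF always_eventually lim])
      (auto intro: abs_le_RF_norm_affine)
next
  assume ?R
  then have "((\<lambda>s. \<bar>q s\<bar> + \<bar>r s + q s * m\<bar>) \<longlongrightarrow> \<bar>0\<bar> + \<bar>0 + 0 * m\<bar>) F"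
    by (intro tendsto_intros) auto
  then show ?L by (simp add: RF_norm_affine)
qed

lemma has_RF_derivative_iff:
  "has_RF_derivative A a b \<eta> (fuzzy_affine A r q) t \<longleftrightarrow>
     ((\<lambda>s. fst (RF_coords A (\<eta> s))) has_field_derivative r) (at t within {a..b}) \<and>
     ((\<lambda>s. snd (RF_coords A (\<eta> s))) has_field_derivative q) (at t within {a..b})"
proof -
  have "RF_diff A (RF_scale A (1 / (s - t)) (RF_diff A (\<eta> s) (\<eta> t))) (fuzzy_affine A r q) =
      fuzzy_affine A
        ((fst (RF_coords A (\<eta> s)) - fst (RF_coords A (\<eta> t))) / (s - t) - r)
        ((snd (RF_coords A (\<eta> s)) - snd (RF_coords A (\<eta> t))) / (s - t) - q)" for s
    by (simp add: RF_diff_def RF_add_def RF_scale_def RF_coords_affine[OF A])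
  moreover have "fuzzy_affine A r q \<in> RF A" by (auto simp: RF_def)
  ultimately show ?thesis
    by (simp add: has_RF_derivative_def tendsto_RF_norm_affine_0_iff has_field_derivative_iff
        LIM_zero_iff)
qed

lemma RF_deriv_eq:
  assumes "a < b" "t \<in> {a..b}"
    and "has_RF_derivative A a b \<eta> D t"
  shows "RF_deriv A a b \<eta> t = D"
  unfolding RF_deriv_def
proof (rule the_equality)
  fix E assume E: "has_RF_derivative A a b \<eta> E t"
  obtain r q r' q' where D: "D = fuzzy_affine A r q" and E': "E = fuzzy_affine A r' q'"
    using assms(3) E by (auto simp: has_RF_derivative_def RF_def)
  have uniq: "x = y" if "(h has_field_derivative x) (at t within {a..b})"
    "(h has_field_derivative y) (at t within {a..b})" for h :: "real \<Rightarrow> real" and x y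
    using that assms(1,2) vector_derivative_unique_within_closed_interval[of a b t h x y]
    by (simp add: has_real_derivative_iff_has_vector_derivative)
  show "E = D"
    using assms(3) E uniq unfolding D E' has_RF_derivative_iff by blast
qed fact

text \<open>Iterates of \<open>RF_deriv\<close> are meaningful on \<open>{a..b}\<close> only, so the induction compares them with
polynomials on that interval; the derivative at a point of \<open>{a..b}\<close>, taken within \<open>{a..b}\<close>, does not
see anything else.\<close>

lemma RF_deriv_iterate_poly:
  assumes "a < b" "t \<in> {a..b}"
  shows "(RF_deriv A a b ^^ j) (\<lambda>t. fuzzy_affine A (poly p t) 0) t =
           fuzzy_affine A (poly ((pderiv ^^ j) p) t) 0"
    and "has_RF_derivative A a b ((RF_deriv A a b ^^ j) (\<lambda>t. fuzzy_affine A (poly p t) 0))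
           (fuzzy_affine A (poly ((pderiv ^^ Suc j) p) t) 0) t"
proof -
  have der: "has_RF_derivative A a b \<eta> (fuzzy_affine A (poly (pderiv p) t) 0) t"
    if "t \<in> {a..b}" "\<And>s. s \<in> {a..b} \<Longrightarrow> \<eta> s = fuzzy_affine A (poly p s) 0" for \<eta> t p
    unfolding has_RF_derivative_iff
  proof
    show "((\<lambda>s. fst (RF_coords A (\<eta> s))) has_field_derivative poly (pderiv p) t)
        (at t within {a..b})"
      by (rule has_field_derivative_transform_within[OF
            has_field_derivative_at_within[OF poly_DERIV] zero_less_one that(1)])
        (simp add: that(2) RF_coords_affine[OF A])
    show "((\<lambda>s. snd (RF_coords A (\<eta> s))) has_field_derivative 0) (at t within {a..b})"
      by (rule has_field_derivative_transform_within[OF DERIV_const zero_less_one that(1)])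
        (simp add: that(2) RF_coords_affine[OF A])
  qed
  have iter: "(RF_deriv A a b ^^ j) (\<lambda>t. fuzzy_affine A (poly p t) 0) t =
      fuzzy_affine A (poly ((pderiv ^^ j) p) t) 0" if "t \<in> {a..b}" for t j
    using that
  proof (induction j arbitrary: t)
    case (Suc j)
    then show ?case using RF_deriv_eq[OF assms(1) _ der] by simp
  qed simp
  show "(RF_deriv A a b ^^ j) (\<lambda>t. fuzzy_affine A (poly p t) 0) t =
      fuzzy_affine A (poly ((pderiv ^^ j) p) t) 0" by (rule iter) fact
  show "has_RF_derivative A a b ((RF_deriv A a b ^^ j) (\<lambda>t. fuzzy_affine A (poly p t) 0))
      (fuzzy_affine A (poly ((pderiv ^^ Suc j) p) t) 0) t"
    using der[OF assms(2) iter] by simp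
qed

lemma poly_in_RF_C:
  assumes "a < b"
  shows "(\<lambda>t. fuzzy_affine A (poly p t) 0) \<in> RF_C A l a b"
proof -
  let ?\<eta> = "(RF_deriv A a b ^^ l) (\<lambda>t. fuzzy_affine A (poly p t) 0)"
  let ?q = "(pderiv ^^ l) p"
  have "((\<lambda>s. RF_norm A (RF_diff A (?\<eta> s) (?\<eta> t))) \<longlongrightarrow> 0) (at t within {a..b})"
    if t: "t \<in> {a..b}" for t
  proof -
    have diff: "RF_diff A (fuzzy_affine A r 0) (fuzzy_affine A s 0) = fuzzy_affine A (r - s) 0"
      for r s
      by (simp add: RF_diff_def RF_add_def RF_scale_def RF_coords_affine[OF A])
    have "((\<lambda>s. poly ?q s - poly ?q t) \<longlongrightarrow> poly ?q t - poly ?q t) (at t within {a..b})"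
      by (intro tendsto_intros)
    then have "((\<lambda>s. RF_norm A (fuzzy_affine A (poly ?q s - poly ?q t) 0)) \<longlongrightarrow> 0)
        (at t within {a..b})"
      by (simp add: tendsto_RF_norm_affine_0_iff)
    then show ?thesis
      by (rule Lim_transform_within[OF _ zero_less_one])
        (auto simp: RF_deriv_iterate_poly(1)[OF assms] RF_deriv_iterate_poly(1)[OF assms t] diff)
  qed
  moreover have "\<exists>D. has_RF_derivative A a b
      ((RF_deriv A a b ^^ j) (\<lambda>t. fuzzy_affine A (poly p t) 0)) D t"
    if "t \<in> {a..b}" for j t
    using RF_deriv_iterate_poly(2)[OF assms that] by blast
  moreover have "fuzzy_affine A (poly p t) 0 \<in> RF A" for t
    by (auto simp: RF_def)
  ultimately show ?thesis
    by (simp add: RF_C_def RF_continuous_on_def)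
qed

text \<open>Besides passing to coordinates, this exchanges a bound on the lengths of the intervals for a
constant gauge: an interval of length less than \<open>\<delta>\<close> lies in the ball of radius \<open>\<delta>\<close> around its
tag, and an interval in a ball of radius \<open>\<delta>/2\<close> is shorter than \<open>\<delta>\<close>.\<close>

lemma has_RF_integral_affine_iff:
  "has_RF_integral A a b f (fuzzy_affine A r q) \<longleftrightarrow>
     has_Riemann_integral (\<lambda>t. fst (RF_coords A (f t))) r a b \<and>
     has_Riemann_integral (\<lambda>t. snd (RF_coords A (f t))) q a b" (is "_ \<longleftrightarrow> ?R r \<and> ?Q q")
proof -
  define S where "S g \<D> = (\<Sum>(x, K)\<in>\<D>. measure lborel K * g (RF_coords A (f x)))"
    for g and \<D> :: "(real \<times> real set) set"
  define mesh where "mesh \<delta> \<D> \<longleftrightarrow> \<D> tagged_division_of {a..b} \<and>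
    (\<forall>(x, K)\<in>\<D>. measure lborel K < \<delta>)" for \<delta> and \<D> :: "(real \<times> real set) set"
  have diff: "RF_diff A (RF_riemann_sum A f \<D>) (fuzzy_affine A r q) =
      fuzzy_affine A (S fst \<D> - r) (S snd \<D> - q)" if "\<D> tagged_division_of {a..b}" for \<D>
    using tagged_division_ofD(1)[OF that]
    by (simp add: RF_diff_def RF_add_def RF_scale_def RF_riemann_sum_eq[OF A]
        RF_coords_affine[OF A] S_def)
  have fine_mesh: "mesh \<delta> \<D>"
    if \<D>: "\<D> tagged_division_of {a..b}" and fine: "(\<lambda>x. ball x (\<delta> / 2)) fine \<D>" and "\<delta> > 0"
    for \<delta> \<D>
    unfolding mesh_def
  proof (intro conjI ballI, safe)
    fix x K assume xK: "(x, K) \<in> \<D>"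
    obtain u v where K: "K = {u..v}" using tagged_division_ofD(4)[OF \<D> xK] by auto
    have "x \<in> K" "K \<subseteq> ball x (\<delta> / 2)" using \<D> fine xK by (auto simp: fine_def)
    moreover from this have "u \<le> v" "u \<in> K" "v \<in> K" using K by auto
    ultimately have "u \<le> v" "dist x u < \<delta> / 2" "dist x v < \<delta> / 2"
      by (auto simp only: mem_ball subset_iff)
    then have "v - u < \<delta>" unfolding dist_real_def by linarith
    then show "measure lborel K < \<delta>" using \<open>u \<le> v\<close> by (simp add: K)
  qed fact
  have mesh_fine: "\<D> tagged_division_of {a..b} \<and> (\<lambda>x. ball x \<delta>) fine \<D>"
    if "mesh \<delta>' \<D>" "\<delta>' \<le> \<delta>" for \<delta> \<delta>' \<D>
  proof
    show \<D>: "\<D> tagged_division_of {a..b}" using that by (simp add: mesh_def)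
    show "(\<lambda>x. ball x \<delta>) fine \<D>"
      unfolding fine_def
    proof (clarify)
      fix x K y assume xK: "(x, K) \<in> \<D>" "y \<in> K"
      obtain u v where K: "K = {u..v}" using tagged_division_ofD(4)[OF \<D> xK(1)] by auto
      have "x \<in> K" using \<D> xK by auto
      moreover have "measure lborel K < \<delta>'" using that(1) xK by (auto simp: mesh_def)
      ultimately show "y \<in> ball x \<delta>" using xK(2) \<open>\<delta>' \<le> \<delta>\<close> unfolding K by (auto simp: dist_real_def)
    qed
  qed
  have main: "has_RF_integral A a b f (fuzzy_affine A r q) \<longleftrightarrow>
      (\<forall>\<epsilon>>0. \<exists>\<delta>>0. \<forall>\<D>. mesh \<delta> \<D> \<longrightarrow> RF_norm A (fuzzy_affine A (S fst \<D> - r) (S snd \<D> - q)) < \<epsilon>)"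
    using diff by (auto simp: has_RF_integral_def mesh_def RF_def)
  show ?thesis
  proof
    assume L: "has_RF_integral A a b f (fuzzy_affine A r q)"
    have "\<exists>\<delta>>0. \<forall>\<D>. \<D> tagged_division_of {a..b} \<and> (\<lambda>x. ball x \<delta>) fine \<D> \<longrightarrow>
        \<bar>S fst \<D> - r\<bar> < \<epsilon> \<and> \<bar>S snd \<D> - q\<bar> < \<epsilon>" if "\<epsilon> > 0" for \<epsilon>
    proof -
      have "\<epsilon> / (1 + \<bar>m\<bar>) > 0" using that by (simp add: add_pos_nonneg)
      then obtain \<delta> where "\<delta> > 0" and \<delta>: "\<And>\<D>. mesh \<delta> \<D> \<Longrightarrow>
          RF_norm A (fuzzy_affine A (S fst \<D> - r) (S snd \<D> - q)) < \<epsilon> / (1 + \<bar>m\<bar>)"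
        using L unfolding main by meson
      have "\<bar>S fst \<D> - r\<bar> < \<epsilon> \<and> \<bar>S snd \<D> - q\<bar> < \<epsilon>" if "mesh \<delta> \<D>" for \<D>
      proof -
        have "(1 + \<bar>m\<bar>) * RF_norm A (fuzzy_affine A (S fst \<D> - r) (S snd \<D> - q)) < \<epsilon>"
          using \<delta>[OF that] by (simp add: pos_less_divide_eq add_pos_nonneg mult.commute)
        then show ?thesis using abs_le_RF_norm_affine order.strict_trans1 by blast
      qed
      then show ?thesis using fine_mesh \<open>\<delta> > 0\<close> by (intro exI[of _ "\<delta> / 2"]) auto
    qed
    then show "?R r \<and> ?Q q" unfolding has_Riemann_integral_def S_def by meson
  next
    assume R: "?R r \<and> ?Q q"
    show "has_RF_integral A a b f (fuzzy_affine A r q)"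
      unfolding main
    proof (intro allI impI)
      fix \<epsilon> :: real assume "\<epsilon> > 0"
      \<comment> \<open>Chosen so that the equivalence constant times two errors of size \<open>\<epsilon>'\<close> gives \<open>\<epsilon>\<close>.\<close>
      define \<epsilon>' where "\<epsilon>' = \<epsilon> / (2 * (1 + \<bar>m\<bar>))"
      have "\<epsilon>' > 0" using \<open>\<epsilon> > 0\<close> by (simp add: \<epsilon>'_def add_pos_nonneg)
      obtain \<delta>1 where "\<delta>1 > 0" and \<delta>1: "\<forall>\<D>. \<D> tagged_division_of {a..b} \<and>
          (\<lambda>x. ball x \<delta>1) fine \<D> \<longrightarrow> \<bar>S fst \<D> - r\<bar> < \<epsilon>'"
        using R \<open>\<epsilon>' > 0\<close> unfolding has_Riemann_integral_def S_def by blast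
      obtain \<delta>2 where "\<delta>2 > 0" and \<delta>2: "\<forall>\<D>. \<D> tagged_division_of {a..b} \<and>
          (\<lambda>x. ball x \<delta>2) fine \<D> \<longrightarrow> \<bar>S snd \<D> - q\<bar> < \<epsilon>'"
        using R \<open>\<epsilon>' > 0\<close> unfolding has_Riemann_integral_def S_def by blast
      have "RF_norm A (fuzzy_affine A (S fst \<D> - r) (S snd \<D> - q)) < \<epsilon>"
        if "mesh (min \<delta>1 \<delta>2) \<D>" for \<D>
      proof -
        have "\<bar>S fst \<D> - r\<bar> + \<bar>S snd \<D> - q\<bar> < 2 * \<epsilon>'"
          using \<delta>1[rule_format, OF mesh_fine[OF that]] \<delta>2[rule_format, OF mesh_fine[OF that]]
          by simp
        then have "(1 + \<bar>m\<bar>) * (\<bar>S fst \<D> - r\<bar> + \<bar>S snd \<D> - q\<bar>) < (1 + \<bar>m\<bar>) * (2 * \<epsilon>')"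
          by (intro mult_strict_left_mono) (auto simp: add_pos_nonneg)
        also have "(1 + \<bar>m\<bar>) * (2 * \<epsilon>') = \<epsilon>"
          using abs_ge_zero[of m] by (simp add: \<epsilon>'_def field_simps)
        finally show ?thesis using RF_norm_affine_le order.strict_trans1 by blast
      qed
      then show "\<exists>\<delta>>0. \<forall>\<D>. mesh \<delta> \<D> \<longrightarrow>
          RF_norm A (fuzzy_affine A (S fst \<D> - r) (S snd \<D> - q)) < \<epsilon>"
        using \<open>\<delta>1 > 0\<close> \<open>\<delta>2 > 0\<close> by (intro exI[of _ "min \<delta>1 \<delta>2"]) auto
    qed
  qed
qed

lemma RF_integral_eq:
  assumes "has_RF_integral A a b f I"
  shows "RF_integral A a b f = I"
  unfolding RF_integral_def
proof (rule the_equality)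
  fix J assume J: "has_RF_integral A a b f J"
  obtain r q r' q' where I': "I = fuzzy_affine A r q" and J': "J = fuzzy_affine A r' q'"
    using assms J by (auto simp: has_RF_integral_def RF_def)
  have uniq: "x = y" if "has_Riemann_integral h x a b" "has_Riemann_integral h y a b" for h x y
    using that by (meson has_Riemann_integral_imp_has_integral has_integral_unique)
  show "J = I"
    using assms J uniq unfolding I' J' has_RF_integral_affine_iff by blast
qed fact

text \<open>The core of the real number \<open>c\<close> is \<open>c\<close>, so in \<open>c B + b c - b c\<close> the last two terms cancel and
only the scalar multiple \<open>c B\<close> is left.\<close>

lemma RF_cross_real:
  "RF_cross A B (fuzzy_affine A c 0) =
     fuzzy_affine A (fst (RF_coords A B) * c) (snd (RF_coords A B) * c)"
  by (simp add: RF_cross_def RF_add_def RF_scale_def RF_coords_affine[OF A]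
      fuzzy_core_affine[OF A(1) m] mult.commute)

text \<open>Every test function \<open>g + 0 A\<close> with continuous \<open>g\<close> does yield an integrable product, so the
integral in the hypotheses of the theorem has the expected value.\<close>

lemma has_RF_integral_cross_continuous:
  assumes f: "RF_integrable A a b f" and "a < b" and g: "continuous_on {a..b} g"
  shows "has_RF_integral A a b (\<lambda>t. RF_cross A (f t) (fuzzy_affine A (g t) 0))
    (fuzzy_affine A (integral {a..b} (\<lambda>t. fst (RF_coords A (f t)) * g t))
                    (integral {a..b} (\<lambda>t. snd (RF_coords A (f t)) * g t)))"
proof -
  obtain r q where "has_RF_integral A a b f (fuzzy_affine A r q)"
    using f by (auto simp: RF_integrable_def has_RF_integral_def RF_def)
  then show ?thesis
    unfolding has_RF_integral_affine_iff RF_cross_real RF_coords_affine[OF A] fst_conv snd_conv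
    using has_Riemann_integral_mult_continuous[OF _ \<open>a < b\<close> g] by blast
qed

end

section \<open>The fundamental lemma for the cross product\<close>

theorem lemma4:
  fixes A :: "real \<Rightarrow> real" and a_m a b :: real and l :: nat
  assumes "fuzzy_number A" and "asymmetric_fuzzy A" and "fuzzy_level A 1 = {a_m}"
    and "a < b"
  shows "(\<forall>f. f \<in> {a..b} \<rightarrow> RF A \<and> RF_integrable A a b f \<and>
            (\<forall>\<eta>\<in>RF_C A l a b.
               (\<forall>j\<le>l. (RF_deriv A a b ^^ j) \<eta> a = RF_zero A \<and>
                       (RF_deriv A a b ^^ j) \<eta> b = RF_zero A) \<longrightarrow>
               RF_integral A a b (\<lambda>t. RF_cross A (f t) (\<eta> t)) \<in> RF_null A) \<longrightarrow>
            (AE t in lebesgue_on {a..b}. f t \<in> RF_null A)) \<and>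
         (\<forall>f. f \<in> {a..b} \<rightarrow> RF A \<and> RF_integrable A a b f \<and>
            (\<forall>\<eta>\<in>RF_C A l a b.
               (\<forall>j\<le>l. (RF_deriv A a b ^^ j) \<eta> a = RF_zero A \<and>
                       (RF_deriv A a b ^^ j) \<eta> b = RF_zero A) \<longrightarrow>
               RF_integral A a b (\<lambda>t. RF_cross A (f t) (\<eta> t)) = RF_zero A) \<longrightarrow>
            (AE t in lebesgue_on {a..b}. f t = RF_zero A))"
proof -
  note A = assms(1,2) and core = assms(1-3)
  \<comment> \<open>\<open>S\<close> is the set that the integrals are known to lie in;
    \<open>\<alpha> r + \<beta> q\<close> is a linear functional vanishing on it.\<close>
  have reduction: "AE t in lebesgue_on {a..b}.
      \<alpha> * fst (RF_coords A (f t)) + \<beta> * snd (RF_coords A (f t)) = 0"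
    if int: "RF_integrable A a b f"
      and orth: "\<And>\<eta>. \<eta> \<in> RF_C A l a b \<Longrightarrow>
        (\<forall>j\<le>l. (RF_deriv A a b ^^ j) \<eta> a = RF_zero A \<and> (RF_deriv A a b ^^ j) \<eta> b = RF_zero A) \<Longrightarrow>
        RF_integral A a b (\<lambda>t. RF_cross A (f t) (\<eta> t)) \<in> S"
      and S: "\<And>r q. fuzzy_affine A r q \<in> S \<Longrightarrow> \<alpha> * r + \<beta> * q = 0"
    for f S \<alpha> \<beta>
  proof -
    obtain r q where "has_RF_integral A a b f (fuzzy_affine A r q)"
      using int by (auto simp: RF_integrable_def has_RF_integral_def RF_def)
    note comps = this[unfolded has_RF_integral_affine_iff[OF core]]
    show ?thesis
    proof (rule AE_linear_combination_zero_if_orthogonal[OF \<open>a < b\<close>])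
      fix p :: "real poly"
      assume flat: "\<And>j. j \<le> l \<Longrightarrow> poly ((pderiv ^^ j) p) a = 0 \<and> poly ((pderiv ^^ j) p) b = 0"
      let ?\<eta> = "\<lambda>t. fuzzy_affine A (poly p t) 0"
      have "RF_integral A a b (\<lambda>t. RF_cross A (f t) (?\<eta> t)) \<in> S"
        using flat
        by (intro orth poly_in_RF_C[OF core \<open>a < b\<close>])
          (simp add: RF_deriv_iterate_poly(1)[OF core \<open>a < b\<close>] less_imp_le[OF \<open>a < b\<close>] RF_zero_def)
      moreover have "continuous_on {a..b} (poly p)" by (intro continuous_intros)
      ultimately show "\<alpha> * integral {a..b} (\<lambda>t. fst (RF_coords A (f t)) * poly p t) +
          \<beta> * integral {a..b} (\<lambda>t. snd (RF_coords A (f t)) * poly p t) = 0"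
        using RF_integral_eq[OF core has_RF_integral_cross_continuous[OF core int \<open>a < b\<close>]]
        by (intro S) simp
    qed (use comps in auto)
  qed
  have repr: "\<exists>r q. f t = fuzzy_affine A r q" if "f \<in> {a..b} \<rightarrow> RF A" "t \<in> {a..b}" for f t
    using funcset_mem[OF that] by (simp add: RF_def)
  show ?thesis
  proof (intro conjI allI impI; elim conjE)
    fix f
    assume f: "f \<in> {a..b} \<rightarrow> RF A" "RF_integrable A a b f"
      and orth: "\<forall>\<eta>\<in>RF_C A l a b.
        (\<forall>j\<le>l. (RF_deriv A a b ^^ j) \<eta> a = RF_zero A \<and> (RF_deriv A a b ^^ j) \<eta> b = RF_zero A) \<longrightarrow>
        RF_integral A a b (\<lambda>t. RF_cross A (f t) (\<eta> t)) \<in> RF_null A"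
    have "AE t in lebesgue_on {a..b}.
        1 * fst (RF_coords A (f t)) + a_m * snd (RF_coords A (f t)) = 0"
    proof (rule reduction[OF f(2)])
      show "1 * r + a_m * q = 0" if "fuzzy_affine A r q \<in> RF_null A" for r q
        using that fuzzy_affine_inject[OF A] by (fastforce simp: RF_null_eq[OF core] mult.commute)
    qed (use orth in blast)
    then show "AE t in lebesgue_on {a..b}. f t \<in> RF_null A"
      using AE_space
    proof eventually_elim
      case (elim t)
      then obtain r q where "f t = fuzzy_affine A r q"
        using repr[OF f(1), of t] by auto
      moreover from this have "r + q * a_m = 0"
        using elim by (simp add: RF_coords_affine[OF A] mult.commute)
      ultimately show ?case unfolding RF_null_eq[OF core] by blast
    qed
  next
    fix f
    assume f: "f \<in> {a..b} \<rightarrow> RF A" "RF_integrable A a b f"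
      and orth: "\<forall>\<eta>\<in>RF_C A l a b.
        (\<forall>j\<le>l. (RF_deriv A a b ^^ j) \<eta> a = RF_zero A \<and> (RF_deriv A a b ^^ j) \<eta> b = RF_zero A) \<longrightarrow>
        RF_integral A a b (\<lambda>t. RF_cross A (f t) (\<eta> t)) = RF_zero A"
    have S: "r = 0 \<and> q = 0" if "fuzzy_affine A r q \<in> {RF_zero A}" for r q
      using that fuzzy_affine_inject[OF A] by (auto simp: RF_zero_def)
    have "AE t in lebesgue_on {a..b}.
        1 * fst (RF_coords A (f t)) + 0 * snd (RF_coords A (f t)) = 0"
      by (rule reduction[OF f(2), where S = "{RF_zero A}"]) (use orth S in auto)
    moreover have "AE t in lebesgue_on {a..b}.
        0 * fst (RF_coords A (f t)) + 1 * snd (RF_coords A (f t)) = 0"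
      by (rule reduction[OF f(2), where S = "{RF_zero A}"]) (use orth S in auto)
    ultimately show "AE t in lebesgue_on {a..b}. f t = RF_zero A"
      using AE_space
    proof eventually_elim
      case (elim t)
      then obtain r q where "f t = fuzzy_affine A r q"
        using repr[OF f(1), of t] by auto
      with elim show ?case by (simp add: RF_zero_def RF_coords_affine[OF A])
    qed
  qed
qed

end
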